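(* Let $\varepsilon>0$. For any time step $\Delta t>0$, if $\phi^k\in\mathcal{C}_{\rm per}$ is point-wise positive and $\phi^{k+1},\mu^{k+1}\in\mathcal{C}_{\rm per}$, with $\phi^{k+1}>0$ point-wise, solve $$\frac{\phi^{k+1}-\phi^{k}}{\Delta t}=\Delta_h \mu^{k+1},\qquad \mu^{k+1}=-\frac{8}{3}(\phi^{k+1})^{-9}+\frac{8}{3}(\phi^{k})^{-3}-\varepsilon^2\Delta_h\phi^{k+1},$$ then $$F_h(\phi^{k+1})+\Delta t\,\|\nabla_h\mu^{k+1}\|_2^2\le F_h(\phi^k).$$
   Context: Let $\Omega=(0,L)^3$, $L>0$, $N\in\mathbb{N}$, $h=L/N$. $\mathcal{C}_{\rm per}$ is the space of real grid functions $\upsilon=(\upsilon_{i,j,k})_{i,j,k\in\mathbb{Z}}$ that are $N$-periodic in each index, where $\upsilon_{i,j,k}=\upsilon(p_i,p_j,p_k)$, $p_i=(i-\tfrac12)h$. The discrete Laplacian is $$\Delta_h\upsilon_{i,j,k}=\frac1{h^2}(\upsilon_{i+1,j,k}+\upsilon_{i-1,j,k}+\upsilon_{i,j+1,k}+\upsilon_{i,j-1,k}+\upsilon_{i,j,k+1}+\upsilon_{i,j,k-1}-6\upsilon_{i,j,k}).$$ The grid inner product is $\langle\upsilon,\xi\rangle_\Omega=h^3\sum_{i,j,k=1}^N\upsilon_{i,j,k}\xi_{i,j,k}$, and $$\|\nabla_h\upsilon\|_2^2=h^3\sum_{i,j,k=1}^N\frac{(\upsilon_{i+1,j,k}-\upsilon_{i,j,k})^2+(\upsilon_{i,j+1,k}-\upsilon_{i,j,k})^2+(\upsilon_{i,j,k+1}-\upsilon_{i,j,k})^2}{h^2}.$$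 Powers of grid functions are taken point-wise. The discrete energy of a positive grid function is $$F_h(\phi)=\frac13\langle\phi^{-8},1\rangle_\Omega+\frac{\varepsilon^2}{2}\|\nabla_h\phi\|_2^2-\frac43\langle\phi^{-2},1\rangle_\Omega.$$ *)

theory Defs
  imports Complex_Main
begin

text \<open>A grid function is represented by its values \<open>v i j k\<close> at the cell-centred nodes
  \<open>((i - 1/2) h, (j - 1/2) h, (k - 1/2) h)\<close>, where \<open>h = L / N\<close>. The node positions themselves
  do not enter any of the discrete operators.\<close>

type_synonym grid_fun = "int \<Rightarrow> int \<Rightarrow> int \<Rightarrow> real"

definition mesh :: "real \<Rightarrow> nat \<Rightarrow> real" where
  "mesh L N = L / real N"

definition C_per :: "nat \<Rightarrow> grid_fun set" where
  "C_per N = {v. \<forall>i j k. v (i + int N) j k = v i j k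
                       \<and> v i (j + int N) k = v i j k
                       \<and> v i j (k + int N) = v i j k}"

definition grid_pos :: "grid_fun \<Rightarrow> bool" where
  "grid_pos v \<longleftrightarrow> (\<forall>i j k. v i j k > 0)"

definition grid_const :: "real \<Rightarrow> grid_fun" where
  "grid_const c = (\<lambda>i j k. c)"

definition grid_pow :: "grid_fun \<Rightarrow> int \<Rightarrow> grid_fun" where
  "grid_pow v n = (\<lambda>i j k. v i j k powi n)"

definition grid_laplacian :: "real \<Rightarrow> nat \<Rightarrow> grid_fun \<Rightarrow> grid_fun" where
  "grid_laplacian L N v = (\<lambda>i j k.
     1 / (mesh L N)\<^sup>2 *
       (v (i + 1) j k + v (i - 1) j k + v i (j + 1) k + v i (j - 1) k
        + v i j (k + 1) + v i j (k - 1) - 6 * v i j k))"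

definition grid_inner :: "real \<Rightarrow> nat \<Rightarrow> grid_fun \<Rightarrow> grid_fun \<Rightarrow> real" where
  "grid_inner L N v w =
     (mesh L N) ^ 3 * (\<Sum>i = 1..int N. \<Sum>j = 1..int N. \<Sum>k = 1..int N. v i j k * w i j k)"

definition grid_grad_norm_sq :: "real \<Rightarrow> nat \<Rightarrow> grid_fun \<Rightarrow> real" where
  "grid_grad_norm_sq L N v =
     (mesh L N) ^ 3 * (\<Sum>i = 1..int N. \<Sum>j = 1..int N. \<Sum>k = 1..int N.
        ((v (i + 1) j k - v i j k)\<^sup>2 + (v i (j + 1) k - v i j k)\<^sup>2
         + (v i j (k + 1) - v i j k)\<^sup>2) / (mesh L N)\<^sup>2)"

text \<open>Only meaningful for positive grid functions, since \<open>0 powi n = 0\<close> for negative \<open>n\<close>.\<close>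

definition grid_energy :: "real \<Rightarrow> nat \<Rightarrow> real \<Rightarrow> grid_fun \<Rightarrow> real" where
  "grid_energy L N \<epsilon> \<phi> =
     1 / 3 * grid_inner L N (grid_pow \<phi> (-8)) (grid_const 1)
     + \<epsilon>\<^sup>2 / 2 * grid_grad_norm_sq L N \<phi>
     - 4 / 3 * grid_inner L N (grid_pow \<phi> (-2)) (grid_const 1)"

end

theory Submission
  imports Defs
begin

text \<open>The scheme is a convex splitting of the energy. The density
  \<open>x\<^sup>-\<^sup>8 / 3\<close> and the gradient term are convex and are treated at the new time level, while
  \<open>- 4/3 x\<^sup>-\<^sup>2\<close> is concave on the positive half-line and is treated at the old level. A convex
  function lies above its tangents, so with \<open>d = \<phi>' - \<phi>\<close> both kinds of terms obey an inequality
  in the same direction, and together they give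
  \<open>F\<^sub>h(\<phi>') - F\<^sub>h(\<phi>) \<le> \<langle>d, \<mu>'\<rangle>\<close> (lemmas \<open>powi_minus_ge_tangent\<close> and
  \<open>grid_grad_norm_sq_diff_le\<close>), whatever the size of the time step.
  The evolution equation turns the right-hand side into
  \<open>\<Delta>t \<langle>\<mu>', \<Delta>\<^sub>h \<mu>'\<rangle>\<close>, which is \<open>- \<Delta>t \<parallel>\<nabla>\<^sub>h \<mu>'\<parallel>\<^sup>2\<close> by summation by parts
  (lemma \<open>grid_inner_laplacian\<close>); the same identity identifies the derivative of the gradient
  energy with \<open>- \<epsilon>\<^sup>2 \<Delta>\<^sub>h \<phi>'\<close>.\<close>

definition grid_sum :: "nat \<Rightarrow> grid_fun \<Rightarrow> real" where
  "grid_sum N f = (\<Sum>i = 1..int N. \<Sum>j = 1..int N. \<Sum>k = 1..int N. f i j k)"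

definition grid_grad_inner :: "real \<Rightarrow> nat \<Rightarrow> grid_fun \<Rightarrow> grid_fun \<Rightarrow> real" where
  "grid_grad_inner L N v w = (mesh L N) ^ 3 * grid_sum N (\<lambda>i j k.
     ((v (i + 1) j k - v i j k) * (w (i + 1) j k - w i j k)
      + (v i (j + 1) k - v i j k) * (w i (j + 1) k - w i j k)
      + (v i j (k + 1) - v i j k) * (w i j (k + 1) - w i j k)) / (mesh L N)\<^sup>2)"

lemma grid_inner_eq_grid_sum:
  "grid_inner L N v w = (mesh L N) ^ 3 * grid_sum N (\<lambda>i j k. v i j k * w i j k)"
  by (simp add: grid_inner_def grid_sum_def)

lemma grid_grad_norm_sq_eq_inner: "grid_grad_norm_sq L N v = grid_grad_inner L N v v"
  by (simp add: grid_grad_norm_sq_def grid_grad_inner_def grid_sum_def power2_eq_square)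

lemma grid_sum_add: "grid_sum N (\<lambda>i j k. f i j k + g i j k) = grid_sum N f + grid_sum N g"
  by (simp add: grid_sum_def sum.distrib)

lemma grid_sum_diff: "grid_sum N (\<lambda>i j k. f i j k - g i j k) = grid_sum N f - grid_sum N g"
  by (simp add: grid_sum_def sum_subtractf)

lemma grid_sum_cmult: "grid_sum N (\<lambda>i j k. c * f i j k) = c * grid_sum N f"
  by (simp add: grid_sum_def sum_distrib_left)

lemma grid_sum_mono: "(\<And>i j k. f i j k \<le> g i j k) \<Longrightarrow> grid_sum N f \<le> grid_sum N g"
  unfolding grid_sum_def by (intro sum_mono)

lemma sum_periodic_shift:
  fixes f :: "int \<Rightarrow> real"
  assumes "\<And>i. f (i + int N) = f i"
  shows "(\<Sum>i = 1..int N. f (i + 1)) = (\<Sum>i = 1..int N. f i)"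
proof (cases "N = 0")
  case False
  have "(\<Sum>i = 1..int N. f (i + 1)) = (\<Sum>i = 2..int N + 1. f i)"
    by (rule sum.reindex_bij_witness[of _ "\<lambda>i. i - 1" "\<lambda>i. i + 1"]) auto
  also have "{2..int N + 1} = insert (int N + 1) {2..int N}"
    using False by auto
  also have "sum f \<dots> = f (1 + int N) + sum f {2..int N}"
    by (subst sum.insert) (auto simp: add.commute)
  also have "\<dots> = f 1 + sum f {2..int N}"
    using assms by simp
  also have "\<dots> = sum f (insert 1 {2..int N})"
    by simp
  also have "insert 1 {2..int N} = {1..int N}"
    using False by auto
  finally show ?thesis .
qed simp

lemma grid_sum_shift:
  assumes "g \<in> C_per N"
  shows "grid_sum N (\<lambda>i j k. g (i + 1) j k) = grid_sum N g"
    and "grid_sum N (\<lambda>i j k. g i (j + 1) k) = grid_sum N g"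
    and "grid_sum N (\<lambda>i j k. g i j (k + 1)) = grid_sum N g"
proof -
  have per: "g (i + int N) j k = g i j k" "g i (j + int N) k = g i j k"
    "g i j (k + int N) = g i j k" for i j k
    using assms by (auto simp: C_per_def)
  show "grid_sum N (\<lambda>i j k. g (i + 1) j k) = grid_sum N g"
    unfolding grid_sum_def
    by (rule sum_periodic_shift[where f = "\<lambda>i. \<Sum>j = 1..int N. \<Sum>k = 1..int N. g i j k"])
       (simp add: per)
  show "grid_sum N (\<lambda>i j k. g i (j + 1) k) = grid_sum N g"
    unfolding grid_sum_def
    by (intro sum.cong refl
          sum_periodic_shift[where f = "\<lambda>j. \<Sum>k = 1..int N. g i j k" for i])
       (simp add: per)
  show "grid_sum N (\<lambda>i j k. g i j (k + 1)) = grid_sum N g"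
    unfolding grid_sum_def
    by (intro sum.cong refl sum_periodic_shift) (simp add: per)
qed

text \<open>In each coordinate direction \<open>w\<^sub>i (v\<^sub>i\<^sub>+\<^sub>1 - 2 v\<^sub>i + v\<^sub>i\<^sub>-\<^sub>1) +
  (w\<^sub>i\<^sub>+\<^sub>1 - w\<^sub>i) (v\<^sub>i\<^sub>+\<^sub>1 - v\<^sub>i)\<close> is the forward difference of
  \<open>w\<^sub>i (v\<^sub>i - v\<^sub>i\<^sub>-\<^sub>1)\<close>, and forward differences of periodic functions sum to zero.\<close>

lemma grid_inner_laplacian:
  assumes "v \<in> C_per N" and "w \<in> C_per N"
  shows "grid_inner L N w (grid_laplacian L N v) = - grid_grad_inner L N w v"
proof -
  define gx where "gx = (\<lambda>i j k. w i j k * (v i j k - v (i - 1) j k))"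
  define gy where "gy = (\<lambda>i j k. w i j k * (v i j k - v i (j - 1) k))"
  define gz where "gz = (\<lambda>i j k. w i j k * (v i j k - v i j (k - 1)))"
  have v_per: "v (i + int N) j k = v i j k" "v i (j + int N) k = v i j k"
    "v i j (k + int N) = v i j k" for i j k
    using assms(1) by (auto simp: C_per_def)
  have v_back: "v (i + int N - 1) j k = v (i - 1) j k" "v i (j + int N - 1) k = v i (j - 1) k"
    "v i j (k + int N - 1) = v i j (k - 1)" for i j k
    using v_per(1)[of "i - 1"] v_per(2)[of _ "j - 1"] v_per(3)[of _ _ "k - 1"]
    by (simp_all add: algebra_simps)
  have per: "gx \<in> C_per N" "gy \<in> C_per N" "gz \<in> C_per N"
    using assms v_back unfolding C_per_def gx_def gy_def gz_def by auto
  let ?grad = "\<lambda>i j k. ((w (i + 1) j k - w i j k) * (v (i + 1) j k - v i j k)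
      + (w i (j + 1) k - w i j k) * (v i (j + 1) k - v i j k)
      + (w i j (k + 1) - w i j k) * (v i j (k + 1) - v i j k)) / (mesh L N)\<^sup>2"
  have "w i j k * grid_laplacian L N v i j k + ?grad i j k
      = 1 / (mesh L N)\<^sup>2 * ((gx (i + 1) j k - gx i j k) + (gy i (j + 1) k - gy i j k)
                            + (gz i j (k + 1) - gz i j k))" for i j k
    unfolding grid_laplacian_def gx_def gy_def gz_def
    by (simp add: algebra_simps flip: add_divide_distrib diff_divide_distrib)
  then have "grid_sum N (\<lambda>i j k. w i j k * grid_laplacian L N v i j k + ?grad i j k) = 0"
    by (simp only: grid_sum_cmult grid_sum_add grid_sum_diff grid_sum_shift per) simp
  then have "grid_sum N (\<lambda>i j k. w i j k * grid_laplacian L N v i j k) = - grid_sum N ?grad"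
    unfolding grid_sum_add by linarith
  then show ?thesis
    by (simp add: grid_inner_eq_grid_sum grid_grad_inner_def)
qed

text \<open>Convexity of \<open>x\<^sup>-\<^sup>n\<close>. After scaling by \<open>a\<^sup>n\<close> this is Bernoulli's inequality for
  \<open>(a / b)\<^sup>n\<close>, combined with \<open>a / b - 1 \<ge> 1 - b / a\<close>.\<close>

lemma powi_minus_ge_tangent:
  fixes a b :: real
  assumes "a > 0" and "b > 0"
  shows "a powi (- int n) - real n * a powi (- int (Suc n)) * (b - a) \<le> b powi (- int n)"
proof -
  have "1 - b / a \<le> a / b - 1"
  proof -
    have "(a / b - 1) - (1 - b / a) = (a - b)\<^sup>2 / (a * b)"
      using assms by (simp add: field_simps power2_eq_square)
    then show ?thesis
      using assms by (smt (verit) divide_nonneg_pos mult_pos_pos zero_le_power2)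
  qed
  then have "1 + real n * (1 - b / a) \<le> 1 + real n * (a / b - 1)"
    by (simp add: mult_left_mono)
  also have "\<dots> \<le> (1 + (a / b - 1)) ^ n"
    by (rule Bernoulli_inequality) (use assms in simp)
  finally have "inverse (a ^ n) * (1 + real n * (1 - b / a)) \<le> inverse (a ^ n) * (a / b) ^ n"
    using assms by (intro mult_left_mono) auto
  moreover have "inverse (a ^ n) * (a / b) ^ n = inverse (b ^ n)"
    using assms by (simp add: field_simps)
  moreover have "inverse (a ^ n) * (1 + real n * (1 - b / a))
      = inverse (a ^ n) - real n * inverse (a ^ Suc n) * (b - a)"
    using assms by (simp add: field_simps)
  ultimately show ?thesis
    by (simp only: power_int_minus power_int_of_nat)
qed

text \<open>Convexity of the squared norm: the defect of the inequality is
  \<open>\<parallel>\<nabla>\<^sub>h (v - w)\<parallel>\<^sup>2\<close>.\<close>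

lemma grid_grad_norm_sq_diff_le:
  assumes "mesh L N \<ge> 0"
  shows "grid_grad_norm_sq L N v - grid_grad_norm_sq L N w
      \<le> 2 * grid_grad_inner L N (\<lambda>i j k. v i j k - w i j k) v"
proof -
  have sq: "(p - q) * (p - q) - (r - s) * (r - s) \<le> 2 * ((p - r - (q - s)) * (p - q))"
    for p q r s :: real
    using zero_le_square[of "p - r - (q - s)"] by (simp add: algebra_simps)
  have pointwise: "((p1 - q1) * (p1 - q1) + (p2 - q2) * (p2 - q2) + (p3 - q3) * (p3 - q3)) / (mesh L N)\<^sup>2
      - ((r1 - s1) * (r1 - s1) + (r2 - s2) * (r2 - s2) + (r3 - s3) * (r3 - s3)) / (mesh L N)\<^sup>2
      \<le> 2 * (((p1 - r1 - (q1 - s1)) * (p1 - q1) + (p2 - r2 - (q2 - s2)) * (p2 - q2)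
              + (p3 - r3 - (q3 - s3)) * (p3 - q3)) / (mesh L N)\<^sup>2)"
    for p1 p2 p3 q1 q2 q3 r1 r2 r3 s1 s2 s3 :: real
    unfolding diff_divide_distrib[symmetric] times_divide_eq_right distrib_left[of 2]
    using sq[of p1 q1 r1 s1] sq[of p2 q2 r2 s2] sq[of p3 q3 r3 s3]
    by (intro divide_right_mono) (linarith, simp)
  show ?thesis
    unfolding grid_grad_norm_sq_eq_inner grid_grad_inner_def right_diff_distrib[symmetric]
      mult.left_commute[of 2] grid_sum_cmult[symmetric] grid_sum_diff[symmetric]
    using assms by (intro mult_left_mono grid_sum_mono pointwise) auto
qed

theorem theorem3p2:
  fixes L \<epsilon> \<Delta>t :: real and N :: nat and \<phi> \<phi>' \<mu>' :: grid_fun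
  assumes "L > 0" and "N \<ge> 1" and "\<epsilon> > 0" and "\<Delta>t > 0"
    and "\<phi> \<in> C_per N" and "grid_pos \<phi>"
    and "\<phi>' \<in> C_per N" and "grid_pos \<phi>'" and "\<mu>' \<in> C_per N"
    and "\<And>i j k. (\<phi>' i j k - \<phi> i j k) / \<Delta>t = grid_laplacian L N \<mu>' i j k"
    and "\<And>i j k. \<mu>' i j k = - (8 / 3) * grid_pow \<phi>' (-9) i j k
           + 8 / 3 * grid_pow \<phi> (-3) i j k - \<epsilon>\<^sup>2 * grid_laplacian L N \<phi>' i j k"
  shows "grid_energy L N \<epsilon> \<phi>' + \<Delta>t * grid_grad_norm_sq L N \<mu>' \<le> grid_energy L N \<epsilon> \<phi>"
proof -
  let ?h3 = "(mesh L N) ^ 3"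
  define d where "d = (\<lambda>i j k. \<phi>' i j k - \<phi> i j k)"
  define m where "m = (\<lambda>i j k. - (8 / 3) * grid_pow \<phi>' (-9) i j k + 8 / 3 * grid_pow \<phi> (-3) i j k)"
  define pot where "pot v = (\<lambda>i j k. 1 / 3 * grid_pow v (-8) i j k - 4 / 3 * grid_pow v (-2) i j k)"
    for v
  have mesh: "mesh L N \<ge> 0"
    using assms(1) by (simp add: mesh_def)
  have d_per: "d \<in> C_per N"
    using assms(5,7) by (auto simp: C_per_def d_def)
  have energy: "grid_energy L N \<epsilon> v
      = ?h3 * grid_sum N (pot v) + \<epsilon>\<^sup>2 / 2 * grid_grad_norm_sq L N v" for v
    unfolding grid_energy_def pot_def grid_inner_eq_grid_sum grid_const_def grid_sum_diff
      grid_sum_cmult by (simp add: algebra_simps)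
  \<comment> \<open>The convex part is compared with its tangent at the new value, the concave part with its
     tangent at the old value.\<close>
  have "pot \<phi>' i j k - pot \<phi> i j k \<le> d i j k * m i j k" for i j k
  proof -
    have pos: "\<phi> i j k > 0" "\<phi>' i j k > 0"
      using assms(6,8) by (auto simp: grid_pos_def)
    show ?thesis
      using powi_minus_ge_tangent[OF pos(2,1), of 8] powi_minus_ge_tangent[OF pos, of 2]
      unfolding pot_def d_def m_def grid_pow_def by (simp add: algebra_simps diff_divide_distrib)
  qed
  then have "grid_sum N (\<lambda>i j k. pot \<phi>' i j k - pot \<phi> i j k) \<le> grid_sum N (\<lambda>i j k. d i j k * m i j k)"
    by (rule grid_sum_mono)
  then have potential: "?h3 * grid_sum N (pot \<phi>') - ?h3 * grid_sum N (pot \<phi>) \<le> grid_inner L N d m"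
    unfolding grid_sum_diff grid_inner_eq_grid_sum right_diff_distrib[symmetric]
    using mesh by (intro mult_left_mono) auto
  have "grid_grad_norm_sq L N \<phi>' - grid_grad_norm_sq L N \<phi>
      \<le> - 2 * grid_inner L N d (grid_laplacian L N \<phi>')"
    using grid_grad_norm_sq_diff_le[OF mesh, of \<phi>' \<phi>] grid_inner_laplacian[OF assms(7) d_per, of L]
    by (simp add: d_def)
  then have "\<epsilon>\<^sup>2 / 2 * (grid_grad_norm_sq L N \<phi>' - grid_grad_norm_sq L N \<phi>)
      \<le> \<epsilon>\<^sup>2 / 2 * (- 2 * grid_inner L N d (grid_laplacian L N \<phi>'))"
    by (rule mult_left_mono) simp
  then have gradient: "\<epsilon>\<^sup>2 / 2 * grid_grad_norm_sq L N \<phi>' - \<epsilon>\<^sup>2 / 2 * grid_grad_norm_sq L N \<phi>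
      \<le> - \<epsilon>\<^sup>2 * grid_inner L N d (grid_laplacian L N \<phi>')"
    by (simp add: algebra_simps)
  have "d i j k * \<mu>' i j k = d i j k * m i j k - \<epsilon>\<^sup>2 * (d i j k * grid_laplacian L N \<phi>' i j k)"
    for i j k
    unfolding m_def assms(11)[of i j k] by (simp add: algebra_simps)
  then have "grid_inner L N d \<mu>'
      = grid_inner L N d m - \<epsilon>\<^sup>2 * grid_inner L N d (grid_laplacian L N \<phi>')"
    by (simp add: grid_inner_eq_grid_sum grid_sum_diff grid_sum_cmult right_diff_distrib)
  then have "grid_energy L N \<epsilon> \<phi>' - grid_energy L N \<epsilon> \<phi> \<le> grid_inner L N d \<mu>'"
    using potential gradient unfolding energy by linarith
  also have "\<dots> = \<Delta>t * grid_inner L N \<mu>' (grid_laplacian L N \<mu>')"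
  proof -
    have "d i j k * \<mu>' i j k = \<Delta>t * (\<mu>' i j k * grid_laplacian L N \<mu>' i j k)" for i j k
      unfolding d_def assms(10)[of i j k, symmetric] using assms(4) by simp
    then show ?thesis
      by (simp only: grid_inner_eq_grid_sum grid_sum_cmult mult.left_commute)
  qed
  also have "\<dots> = - \<Delta>t * grid_grad_norm_sq L N \<mu>'"
    by (simp add: grid_inner_laplacian[OF assms(9,9)] grid_grad_norm_sq_eq_inner)
  finally show ?thesis
    by simp
qed

end
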